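(* Let $G$ be a finitely generated group. Suppose there exist a torsion-free trivial $G$-module $M$ and a nonzero global fixed point $[c]\in H^1(G,M)$ under the canonical action of $\mathrm{Aut}(G)$ on $H^1(G,M)$. Then $G$ has property $R_\infty$.
   Context: A trivial $G$-module $M$ is a $\mathbb{Z}[G]$-module on which the elements of $G$ act as the identity; torsion-free means torsion-free as an abelian group. For trivial $M$ one has the canonical identification $H^1(G,M)\cong\mathrm{Hom}(G,M)$, under which the canonical action of $\mathrm{Aut}(G)$ is $(\varphi,f)\mapsto f\circ\varphi^{-1}$. A global fixed point of an action of a group $H$ on a set $X$ is an $x\in X$ with $h(x)=x$ for all $h\in H$. For $\varphi\in\mathrm{Aut}(G)$, the Reidemeister number $R(\varphi)$ is the number of orbits of the $\varphi$-twisted conjugation action $G\times G\to G$, $(g,a)\mapsto g\,a\,\varphi(g)^{-1}$; $G$ has property $R_\infty$ if $R(\varphi)=\infty$ for every $\varphi\in\mathrm{Aut}(G)$. *)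

theory Defs
  imports "HOL-Algebra.Group_Action" "HOL-Algebra.Generated_Groups" "HOL-Library.Extended_Nat"
begin

text \<open>
  Groups are those of HOL-Algebra. The abelian group underlying a module is a \<^locale>\<open>comm_group\<close>,
  hence written multiplicatively: its zero is the unit, and n-fold multiples are powers.
\<close>

definition finitely_generated :: "('a, 'k) monoid_scheme \<Rightarrow> bool" where
  "finitely_generated G \<longleftrightarrow>
     (\<exists>S. finite S \<and> S \<subseteq> carrier G \<and> generate G S = carrier G)"

definition torsion_free :: "('b, 'm) monoid_scheme \<Rightarrow> bool" where
  "torsion_free M \<longleftrightarrow>
     (\<forall>m\<in>carrier M. \<forall>n::nat. 0 < n \<longrightarrow> m [^]\<^bsub>M\<^esub> n = \<one>\<^bsub>M\<^esub> \<longrightarrow> m = \<one>\<^bsub>M\<^esub>)"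

definition global_fixed_point ::
    "('h, 'k) monoid_scheme \<Rightarrow> 'x set \<Rightarrow> ('h \<Rightarrow> 'x \<Rightarrow> 'x) \<Rightarrow> 'x \<Rightarrow> bool" where
  "global_fixed_point H E act x \<longleftrightarrow> x \<in> E \<and> (\<forall>h\<in>carrier H. act h x = x)"

subsection \<open>Modules over a group and first cohomology\<close>

text \<open>
  A module over the integral group ring of \<open>G\<close> is given as an abelian group \<open>M\<close> together with a
  homomorphism from \<open>G\<close> to the group of automorphisms of \<open>M\<close>.
\<close>

locale G_module =
  group_hom G "AutoGroup M" \<rho> + M: comm_group M
  for G :: "('a, 'k) monoid_scheme" (structure)
    and M :: "('b, 'm) monoid_scheme"
    and \<rho> :: "'a \<Rightarrow> 'b \<Rightarrow> 'b"

locale trivial_G_module = G_module +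
  assumes trivial: "\<lbrakk>g \<in> carrier G; m \<in> carrier M\<rbrakk> \<Longrightarrow> \<rho> g m = m"

definition cocycles1 ::
    "('a, 'k) monoid_scheme \<Rightarrow> ('b, 'm) monoid_scheme \<Rightarrow> ('a \<Rightarrow> 'b \<Rightarrow> 'b) \<Rightarrow> ('a \<Rightarrow> 'b) set" where
  "cocycles1 G M \<rho> =
     {c \<in> carrier G \<rightarrow>\<^sub>E carrier M.
        \<forall>g\<in>carrier G. \<forall>h\<in>carrier G. c (g \<otimes>\<^bsub>G\<^esub> h) = c g \<otimes>\<^bsub>M\<^esub> \<rho> g (c h)}"

definition coboundaries1 ::
    "('a, 'k) monoid_scheme \<Rightarrow> ('b, 'm) monoid_scheme \<Rightarrow> ('a \<Rightarrow> 'b \<Rightarrow> 'b) \<Rightarrow> ('a \<Rightarrow> 'b) set" where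
  "coboundaries1 G M \<rho> =
     {\<lambda>g\<in>carrier G. \<rho> g m \<otimes>\<^bsub>M\<^esub> inv\<^bsub>M\<^esub> m | m. m \<in> carrier M}"

definition cocycle_group1 ::
    "('a, 'k) monoid_scheme \<Rightarrow> ('b, 'm) monoid_scheme \<Rightarrow> ('a \<Rightarrow> 'b \<Rightarrow> 'b) \<Rightarrow> ('a \<Rightarrow> 'b) monoid" where
  "cocycle_group1 G M \<rho> =
     \<lparr>carrier = cocycles1 G M \<rho>,
      mult = \<lambda>c d. \<lambda>g\<in>carrier G. c g \<otimes>\<^bsub>M\<^esub> d g,
      one = \<lambda>g\<in>carrier G. \<one>\<^bsub>M\<^esub>\<rparr>"

definition H1 ::
    "('a, 'k) monoid_scheme \<Rightarrow> ('b, 'm) monoid_scheme \<Rightarrow> ('a \<Rightarrow> 'b \<Rightarrow> 'b) \<Rightarrow> ('a \<Rightarrow> 'b) set monoid" where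
  "H1 G M \<rho> = cocycle_group1 G M \<rho> Mod coboundaries1 G M \<rho>"

text \<open>
  The action of an automorphism \<open>\<phi>\<close> sends the class of \<open>c\<close> to the class of the composition of \<open>c\<close>
  with the inverse of \<open>\<phi>\<close>; a class is a coset, and \<open>\<phi>\<close> acts on it elementwise. This is an action
  on \<open>H1 G M \<rho>\<close> when the module is trivial (see below), the only case in which it is used.
\<close>

definition Aut_act_H1 ::
    "('a, 'k) monoid_scheme \<Rightarrow> ('b, 'm) monoid_scheme \<Rightarrow> ('a \<Rightarrow> 'b \<Rightarrow> 'b)
       \<Rightarrow> ('a \<Rightarrow> 'a) \<Rightarrow> ('a \<Rightarrow> 'b) set \<Rightarrow> ('a \<Rightarrow> 'b) set" where
  "Aut_act_H1 G M \<rho> \<phi> =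
     (\<lambda>\<xi>\<in>carrier (H1 G M \<rho>). (\<lambda>c. compose (carrier G) c (inv\<^bsub>AutoGroup G\<^esub> \<phi>)) ` \<xi>)"

subsection \<open>Twisted conjugation\<close>

definition twisted_conj ::
    "('a, 'k) monoid_scheme \<Rightarrow> ('a \<Rightarrow> 'a) \<Rightarrow> 'a \<Rightarrow> 'a \<Rightarrow> 'a" where
  "twisted_conj G \<phi> g = (\<lambda>a\<in>carrier G. g \<otimes>\<^bsub>G\<^esub> a \<otimes>\<^bsub>G\<^esub> inv\<^bsub>G\<^esub> (\<phi> g))"

definition Reidemeister_number :: "('a, 'k) monoid_scheme \<Rightarrow> ('a \<Rightarrow> 'a) \<Rightarrow> enat" where
  "Reidemeister_number G \<phi> =
     (let O\<phi> = orbits G (carrier G) (twisted_conj G \<phi>)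
      in if finite O\<phi> then enat (card O\<phi>) else \<infinity>)"

definition R_infinity :: "('a, 'k) monoid_scheme \<Rightarrow> bool" where
  "R_infinity G \<longleftrightarrow> (\<forall>\<phi>\<in>carrier (AutoGroup G). Reidemeister_number G \<phi> = \<infinity>)"

subsection \<open>Identification of the first cohomology of a trivial module with homomorphisms\<close>

lemma (in G_module) act_auto: "g \<in> carrier G \<Longrightarrow> \<rho> g \<in> auto M"
  using hom_closed by (simp add: AutoGroup_def)

lemma (in trivial_G_module) cocycles1_eq_hom:
  "cocycles1 G M \<rho> = hom G M \<inter> extensional (carrier G)"
  unfolding cocycles1_def hom_def
  by (auto simp: trivial PiE_def Pi_iff)

lemma (in trivial_G_module) coboundaries1_eq:
  "coboundaries1 G M \<rho> = {\<lambda>g\<in>carrier G. \<one>\<^bsub>M\<^esub>}"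
proof -
  have "coboundaries1 G M \<rho> = (\<lambda>m. \<lambda>g\<in>carrier G. \<one>\<^bsub>M\<^esub>) ` carrier M"
    unfolding coboundaries1_def Setcompr_eq_image
    by (intro image_cong refl restrict_ext) (simp add: trivial)
  then show ?thesis
    using M.one_closed by auto
qed

lemma (in trivial_G_module) carrier_H1:
  "carrier (H1 G M \<rho>) = (\<lambda>f. {f}) ` (hom G M \<inter> extensional (carrier G))"
proof -
  have *: "(\<lambda>g\<in>carrier G. (\<lambda>g\<in>carrier G. \<one>\<^bsub>M\<^esub>) g \<otimes>\<^bsub>M\<^esub> f g) = f"
    if "f \<in> hom G M \<inter> extensional (carrier G)" for f
    using that by (intro extensionalityI[of _ "carrier G"]) (auto simp: hom_def Pi_iff)
  show ?thesis
    by (simp add: H1_def FactGroup_def RCOSETS_def r_coset_def coboundaries1_eq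
        cocycle_group1_def cocycles1_eq_hom * image_def cong: conj_cong) (use * in auto)
qed

lemma (in trivial_G_module) one_H1: "\<one>\<^bsub>H1 G M \<rho>\<^esub> = {\<lambda>g\<in>carrier G. \<one>\<^bsub>M\<^esub>}"
  by (simp add: H1_def FactGroup_def coboundaries1_eq)

lemma (in trivial_G_module) mult_H1:
  "{f} \<otimes>\<^bsub>H1 G M \<rho>\<^esub> {f'} = {\<lambda>g\<in>carrier G. f g \<otimes>\<^bsub>M\<^esub> f' g}"
  by (simp add: H1_def FactGroup_def set_mult_def cocycle_group1_def)

lemma (in trivial_G_module) Aut_act_H1_eq:
  assumes "f \<in> hom G M \<inter> extensional (carrier G)" "\<phi> \<in> carrier (AutoGroup G)"
  shows "Aut_act_H1 G M \<rho> \<phi> {f} = {compose (carrier G) f (inv\<^bsub>AutoGroup G\<^esub> \<phi>)}"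
  using assms by (simp add: Aut_act_H1_def carrier_H1)

lemma (in G_module) comm_group_cocycle_group1: "comm_group (cocycle_group1 G M \<rho>)"
proof -
  have hm: "\<rho> g (x \<otimes>\<^bsub>M\<^esub> y) = \<rho> g x \<otimes>\<^bsub>M\<^esub> \<rho> g y"
    if "g \<in> carrier G" "x \<in> carrier M" "y \<in> carrier M" for g x y
    using act_auto[OF that(1)] that by (auto simp: auto_def hom_def)
  have hc: "\<rho> g x \<in> carrier M" if "g \<in> carrier G" "x \<in> carrier M" for g x
    using act_auto[OF that(1)] that by (auto simp: auto_def hom_def)
  have h1: "\<rho> g \<one>\<^bsub>M\<^esub> = \<one>\<^bsub>M\<^esub>" if "g \<in> carrier G" for g
    using hm[OF that M.one_closed M.one_closed] hc[OF that M.one_closed] by simp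
  have hi: "\<rho> g (inv\<^bsub>M\<^esub> x) = inv\<^bsub>M\<^esub> (\<rho> g x)" if "g \<in> carrier G" "x \<in> carrier M" for g x
    using hm[OF that(1) M.inv_closed[OF that(2)] that(2)] hc[OF that(1)] that h1
    by (intro M.inv_equality[symmetric]) simp_all
  let ?Z = "cocycle_group1 G M \<rho>"
  have cc: "c g \<in> carrier M" if "c \<in> cocycles1 G M \<rho>" "g \<in> carrier G" for c g
    using that by (auto simp: cocycles1_def)
  have cm: "c (g \<otimes> h) = c g \<otimes>\<^bsub>M\<^esub> \<rho> g (c h)"
    if "c \<in> cocycles1 G M \<rho>" "g \<in> carrier G" "h \<in> carrier G" for c g h
    using that by (auto simp: cocycles1_def)
  have ce: "c \<in> extensional (carrier G)" if "c \<in> cocycles1 G M \<rho>" for c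
    using that by (simp add: cocycles1_def PiE_def)
  have cI: "(\<lambda>g\<in>carrier G. u g) \<in> cocycles1 G M \<rho>"
    if "\<And>g. g \<in> carrier G \<Longrightarrow> u g \<in> carrier M"
      "\<And>g h. \<lbrakk>g \<in> carrier G; h \<in> carrier G\<rbrakk> \<Longrightarrow> u (g \<otimes> h) = u g \<otimes>\<^bsub>M\<^esub> \<rho> g (u h)" for u
    using that by (auto simp: cocycles1_def)
  have carr: "carrier ?Z = cocycles1 G M \<rho>"
    and mult: "\<And>c d. c \<otimes>\<^bsub>?Z\<^esub> d = (\<lambda>g\<in>carrier G. c g \<otimes>\<^bsub>M\<^esub> d g)"
    and one: "\<one>\<^bsub>?Z\<^esub> = (\<lambda>g\<in>carrier G. \<one>\<^bsub>M\<^esub>)"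
    by (simp_all add: cocycle_group1_def)
  show ?thesis
  proof (rule comm_groupI, unfold carr mult one)
    fix c d assume c: "c \<in> cocycles1 G M \<rho>" and d: "d \<in> cocycles1 G M \<rho>"
    show "(\<lambda>g\<in>carrier G. c g \<otimes>\<^bsub>M\<^esub> d g) \<in> cocycles1 G M \<rho>"
      by (rule cI) (use c d in \<open>simp_all add: cc cm hm hc M.m_ac\<close>)
    show "(\<lambda>g\<in>carrier G. c g \<otimes>\<^bsub>M\<^esub> d g) = (\<lambda>g\<in>carrier G. d g \<otimes>\<^bsub>M\<^esub> c g)"
      by (rule restrict_ext) (use c d in \<open>simp add: cc M.m_comm\<close>)
    fix e assume e: "e \<in> cocycles1 G M \<rho>"
    show "(\<lambda>g\<in>carrier G. (\<lambda>g\<in>carrier G. c g \<otimes>\<^bsub>M\<^esub> d g) g \<otimes>\<^bsub>M\<^esub> e g)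
        = (\<lambda>g\<in>carrier G. c g \<otimes>\<^bsub>M\<^esub> (\<lambda>g\<in>carrier G. d g \<otimes>\<^bsub>M\<^esub> e g) g)"
      by (rule restrict_ext) (use c d e in \<open>simp add: cc M.m_assoc\<close>)
  next
    show "(\<lambda>g\<in>carrier G. \<one>\<^bsub>M\<^esub>) \<in> cocycles1 G M \<rho>"
      by (rule cI) (simp_all add: h1)
  next
    fix c assume c: "c \<in> cocycles1 G M \<rho>"
    show "(\<lambda>g\<in>carrier G. (\<lambda>g\<in>carrier G. \<one>\<^bsub>M\<^esub>) g \<otimes>\<^bsub>M\<^esub> c g) = c"
      by (rule extensionalityI[of _ "carrier G"]) (use c in \<open>simp_all add: cc ce\<close>)
    have "(\<lambda>g\<in>carrier G. inv\<^bsub>M\<^esub> c g) \<in> cocycles1 G M \<rho>"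
      by (rule cI) (use c in \<open>simp_all add: cc cm hc hi M.inv_mult\<close>)
    moreover have "(\<lambda>g\<in>carrier G. (\<lambda>g\<in>carrier G. inv\<^bsub>M\<^esub> c g) g \<otimes>\<^bsub>M\<^esub> c g)
        = (\<lambda>g\<in>carrier G. \<one>\<^bsub>M\<^esub>)"
      by (rule restrict_ext) (use c in \<open>simp add: cc\<close>)
    ultimately show "\<exists>d\<in>cocycles1 G M \<rho>.
        (\<lambda>g\<in>carrier G. d g \<otimes>\<^bsub>M\<^esub> c g) = (\<lambda>g\<in>carrier G. \<one>\<^bsub>M\<^esub>)" by blast
  qed
qed

lemma (in trivial_G_module) group_H1: "group (H1 G M \<rho>)"
proof -
  interpret Z: comm_group "cocycle_group1 G M \<rho>" by (rule comm_group_cocycle_group1)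
  have "coboundaries1 G M \<rho> = {\<one>\<^bsub>cocycle_group1 G M \<rho>\<^esub>}"
    by (simp add: coboundaries1_eq cocycle_group1_def)
  then show ?thesis
    unfolding H1_def using Z.one_is_normal normal.factorgroup_is_group by metis
qed

lemma (in trivial_G_module) group_action_H1:
  "group_action (AutoGroup G) (carrier (H1 G M \<rho>)) (Aut_act_H1 G M \<rho>)"
proof -
  let ?A = "AutoGroup G" and ?X = "carrier (H1 G M \<rho>)" and ?a = "Aut_act_H1 G M \<rho>"
  let ?H = "hom G M \<inter> extensional (carrier G)"
  interpret A: group ?A by (rule G.AutoGroup)
  have Ahom: "\<phi> \<in> hom G G" "\<phi> \<in> extensional (carrier G)" if "\<phi> \<in> carrier ?A" for \<phi>
    using that by (auto simp: AutoGroup_def auto_def Bij_def)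
  have Amult: "\<phi> \<otimes>\<^bsub>?A\<^esub> \<psi> = compose (carrier G) \<phi> \<psi>"
    if "\<phi> \<in> carrier ?A" "\<psi> \<in> carrier ?A" for \<phi> \<psi>
    using that by (simp add: AutoGroup_def BijGroup_def auto_def)
  have Aone: "\<one>\<^bsub>?A\<^esub> = (\<lambda>x\<in>carrier G. x)"
    by (simp add: AutoGroup_def BijGroup_def)
  have cl: "compose (carrier G) f \<phi> \<in> ?H" if "f \<in> ?H" "\<phi> \<in> carrier ?A" for f \<phi>
    using G.hom_compose[OF Ahom(1)[OF that(2)], of f M] that(1) by simp
  have act: "?a \<phi> {f} = {compose (carrier G) f (inv\<^bsub>?A\<^esub> \<phi>)}"
    if "f \<in> ?H" "\<phi> \<in> carrier ?A" for f \<phi>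
    by (rule Aut_act_H1_eq[OF that])
  have acl: "?a \<phi> x \<in> ?X" if "x \<in> ?X" "\<phi> \<in> carrier ?A" for x \<phi>
    using that cl[OF _ A.inv_closed] act unfolding carrier_H1 by fastforce
  have comp: "?a (\<phi> \<otimes>\<^bsub>?A\<^esub> \<psi>) x = ?a \<phi> (?a \<psi> x)"
    if x: "x \<in> ?X" and p: "\<phi> \<in> carrier ?A" "\<psi> \<in> carrier ?A" for x \<phi> \<psi>
  proof -
    obtain f where f: "f \<in> ?H" "x = {f}" using x by (auto simp: carrier_H1)
    have "inv\<^bsub>?A\<^esub> \<phi> \<in> carrier G \<rightarrow> carrier G"
      using Ahom(1)[OF A.inv_closed[OF p(1)]] by (simp add: hom_def)
    then have "compose (carrier G) f (inv\<^bsub>?A\<^esub> (\<phi> \<otimes>\<^bsub>?A\<^esub> \<psi>))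
        = compose (carrier G) (compose (carrier G) f (inv\<^bsub>?A\<^esub> \<psi>)) (inv\<^bsub>?A\<^esub> \<phi>)"
      unfolding A.inv_mult_group[OF p] Amult[OF A.inv_closed[OF p(2)] A.inv_closed[OF p(1)]]
      by (simp add: compose_assoc)
    then show ?thesis
      unfolding f(2) act[OF f(1) p(2)] act[OF f(1) A.m_closed[OF p]]
        act[OF cl[OF f(1) A.inv_closed[OF p(2)]] p(1)]
      by simp
  qed
  have one: "?a \<one>\<^bsub>?A\<^esub> x = x" if "x \<in> ?X" for x
    using that by (auto simp: carrier_H1 Aut_act_H1_eq Aone[symmetric])
      (auto simp: Aone compose_def intro!: extensionalityI[of _ "carrier G"])
  have bij: "?a \<phi> \<in> Bij ?X" if p: "\<phi> \<in> carrier ?A" for \<phi>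
  proof -
    have "bij_betw (?a \<phi>) ?X ?X"
      by (rule bij_betw_byWitness[where f' = "?a (inv\<^bsub>?A\<^esub> \<phi>)"])
         (use p acl comp[symmetric] one in auto)
    then show ?thesis by (simp add: Bij_def Aut_act_H1_def)
  qed
  have "?a \<in> hom ?A (BijGroup ?X)"
  proof (rule homI)
    show "?a \<phi> \<in> carrier (BijGroup ?X)" if "\<phi> \<in> carrier ?A" for \<phi>
      using bij[OF that] by (simp add: BijGroup_def)
    show "?a (\<phi> \<otimes>\<^bsub>?A\<^esub> \<psi>) = ?a \<phi> \<otimes>\<^bsub>BijGroup ?X\<^esub> ?a \<psi>"
      if "\<phi> \<in> carrier ?A" "\<psi> \<in> carrier ?A" for \<phi> \<psi>
    proof -
      have "?a (\<phi> \<otimes>\<^bsub>?A\<^esub> \<psi>) = compose ?X (?a \<phi>) (?a \<psi>)"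
      proof (rule extensionalityI[of _ ?X])
        show "?a (\<phi> \<otimes>\<^bsub>?A\<^esub> \<psi>) \<in> extensional ?X"
          unfolding Aut_act_H1_def by (rule restrict_extensional)
        show "?a (\<phi> \<otimes>\<^bsub>?A\<^esub> \<psi>) x = compose ?X (?a \<phi>) (?a \<psi>) x" if "x \<in> ?X" for x
          using comp[OF that \<open>\<phi> \<in> carrier ?A\<close> \<open>\<psi> \<in> carrier ?A\<close>] that by (simp add: compose_eq)
      qed (rule compose_extensional)
      then show ?thesis
        using that bij by (simp add: BijGroup_def)
    qed
  qed
  then show ?thesis
    unfolding group_action_def group_hom_def group_hom_axioms_def
    using group_BijGroup A.is_group by blast
qed

end

theory Submission
  imports Defs
begin

text \<open>
  Coboundaries of a trivial module vanish, so a nonzero fixed class is a nontrivial homomorphism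
  \<open>f\<close> from \<open>G\<close> to \<open>M\<close> with \<open>f \<circ> \<phi> = f\<close> for every automorphism \<open>\<phi>\<close>. Since \<open>M\<close> is abelian, the
  contributions of \<open>g\<close> and \<open>\<phi> g\<close> cancel in the value of \<open>f\<close> at a \<open>\<phi>\<close>-twisted conjugate of \<open>a\<close> by
  \<open>g\<close>, so \<open>f\<close> is constant on twisted conjugacy classes, and there are at least as many classes as
  values of \<open>f\<close> (\<open>Reidemeister_number_infinite_if_invariant_hom\<close>). A nontrivial homomorphism into a
  torsion-free group has infinitely many values: the powers of any nontrivial value are pairwise
  distinct (\<open>infinite_image_if_torsion_free\<close>).
\<close>

lemma (in group) infinite_powers_if_torsion_free:
  assumes "torsion_free G" "x \<in> carrier G" "x \<noteq> \<one>"
  shows "infinite (range (\<lambda>n::nat. x [^] n))"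
proof -
  have "x [^] m \<noteq> x [^] n" if "m < n" for m n :: nat
  proof
    assume "x [^] m = x [^] n"
    then have "x [^] (n - m) = \<one>"
      using pow_eq_div2[OF assms(2), of n m] by simp
    then show False
      using assms that zero_less_diff unfolding torsion_free_def by blast
  qed
  then have "inj (\<lambda>n::nat. x [^] n)"
    by (intro linorder_injI) auto
  then show ?thesis
    using finite_imageD by blast
qed

lemma (in group_hom) infinite_image_if_torsion_free:
  assumes "torsion_free H" "x \<in> carrier G" "h x \<noteq> \<one>\<^bsub>H\<^esub>"
  shows "infinite (h ` carrier G)"
proof
  assume "finite (h ` carrier G)"
  moreover have "range (\<lambda>n::nat. h x [^]\<^bsub>H\<^esub> n) \<subseteq> h ` carrier G"
  proof (rule image_subsetI)
    show "h x [^]\<^bsub>H\<^esub> n \<in> h ` carrier G" for n :: nat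
      using hom_nat_pow[OF assms(2), of n] G.nat_pow_closed[OF assms(2), of n] by (metis imageI)
  qed
  ultimately show False
    using H.infinite_powers_if_torsion_free[OF assms(1) hom_closed[OF assms(2)] assms(3)]
      finite_subset by blast
qed

lemma (in group_hom) hom_twisted_conj:
  assumes "comm_group H" "\<phi> \<in> hom G G" "\<And>x. x \<in> carrier G \<Longrightarrow> h (\<phi> x) = h x"
    and "g \<in> carrier G" "a \<in> carrier G"
  shows "h (twisted_conj G \<phi> g a) = h a"
proof -
  interpret H: comm_group H by fact
  have "\<phi> g \<in> carrier G"
    using assms(2,4) by (auto simp: hom_def)
  then have "h (twisted_conj G \<phi> g a) = h g \<otimes>\<^bsub>H\<^esub> h a \<otimes>\<^bsub>H\<^esub> inv\<^bsub>H\<^esub> (h g)"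
    using assms(3-5) by (simp add: twisted_conj_def)
  also have "\<dots> = h a"
    using assms(4,5) by (simp add: H.m_comm[of "h g"] H.m_assoc)
  finally show ?thesis .
qed

text \<open>
  By \<open>hom_twisted_conj\<close>, the map sending a twisted conjugacy class to the common value of \<open>h\<close> on it
  is well defined, and it maps the set of classes onto the image of \<open>h\<close>.
\<close>
lemma (in group_hom) Reidemeister_number_infinite_if_invariant_hom:
  assumes "comm_group H" "\<phi> \<in> hom G G" "\<And>x. x \<in> carrier G \<Longrightarrow> h (\<phi> x) = h x"
    and "infinite (h ` carrier G)"
  shows "Reidemeister_number G \<phi> = \<infinity>"
proof -
  let ?O = "orbits G (carrier G) (twisted_conj G \<phi>)"
  have image_orbit: "h ` orbit G (twisted_conj G \<phi>) a = {h a}" if a: "a \<in> carrier G" for a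
  proof -
    have "h ` orbit G (twisted_conj G \<phi>) a = (\<lambda>g. h (twisted_conj G \<phi> g a)) ` carrier G"
      unfolding orbit_def by blast
    also have "\<dots> = (\<lambda>g. h a) ` carrier G"
      by (rule image_cong[OF refl]) (rule hom_twisted_conj[OF assms(1-3) _ a])
    also have "\<dots> = {h a}"
      using G.one_closed by blast
    finally show ?thesis .
  qed
  have "h ` carrier G \<subseteq> (\<lambda>C. the_elem (h ` C)) ` ?O"
  proof
    fix y assume "y \<in> h ` carrier G"
    then obtain a where a: "a \<in> carrier G" "y = h a" by blast
    then have "y = the_elem (h ` orbit G (twisted_conj G \<phi>) a)"
      by (simp add: image_orbit)
    then show "y \<in> (\<lambda>C. the_elem (h ` C)) ` ?O"
      using a(1) unfolding orbits_def by blast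
  qed
  then have "infinite ?O"
    using assms(4) finite_surj by blast
  then show ?thesis
    by (simp add: Reidemeister_number_def)
qed

lemma (in trivial_G_module) fixed_class_imp_invariant_hom:
  assumes "f \<in> hom G M \<inter> extensional (carrier G)"
    and "\<phi> \<in> carrier (AutoGroup G)" "Aut_act_H1 G M \<rho> \<phi> {f} = {f}" "x \<in> carrier G"
  shows "f (\<phi> x) = f x"
proof -
  interpret A: group "AutoGroup G" by (rule G.AutoGroup)
  let ?\<psi> = "inv\<^bsub>AutoGroup G\<^esub> \<phi>"
  have closed: "\<phi> x \<in> carrier G"
    using assms(2,4) by (auto simp: AutoGroup_def auto_def hom_def)
  have "?\<psi> (\<phi> x) = (?\<psi> \<otimes>\<^bsub>AutoGroup G\<^esub> \<phi>) x"
    using assms(2,4) A.inv_closed[OF assms(2)]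
    by (simp add: AutoGroup_def BijGroup_def auto_def compose_eq)
  also have "\<dots> = x"
    unfolding A.l_inv[OF assms(2)] using assms(4) by (simp add: AutoGroup_def BijGroup_def)
  finally have inverse: "?\<psi> (\<phi> x) = x" .
  have "compose (carrier G) f ?\<psi> = f"
    using assms(3) Aut_act_H1_eq[OF assms(1,2)] by simp
  then have "f (\<phi> x) = f (?\<psi> (\<phi> x))"
    using compose_eq[OF closed, of f ?\<psi>] by simp
  then show ?thesis
    by (simp add: inverse)
qed

theorem theorem5p4:
  fixes G :: "('a, 'k) monoid_scheme"
    and M :: "('b, 'm) monoid_scheme"
    and \<rho> :: "'a \<Rightarrow> 'b \<Rightarrow> 'b"
    and \<xi> :: "('a \<Rightarrow> 'b) set"
  assumes "group G"
    and "finitely_generated G"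
    and "trivial_G_module G M \<rho>"
    and "torsion_free M"
    and "global_fixed_point (AutoGroup G) (carrier (H1 G M \<rho>)) (Aut_act_H1 G M \<rho>) \<xi>"
    and "\<xi> \<noteq> \<one>\<^bsub>H1 G M \<rho>\<^esub>"
  shows "R_infinity G"
proof -
  interpret T: trivial_G_module G M \<rho> by fact
  obtain f where f: "f \<in> hom G M \<inter> extensional (carrier G)" and \<xi>: "\<xi> = {f}"
    using assms(5) by (auto simp: global_fixed_point_def T.carrier_H1)
  interpret f: group_hom G M f
    using f by unfold_locales simp
  have "f \<noteq> (\<lambda>g\<in>carrier G. \<one>\<^bsub>M\<^esub>)"
    using assms(6) by (simp add: \<xi> T.one_H1)
  then obtain x where x: "x \<in> carrier G" "f x \<noteq> \<one>\<^bsub>M\<^esub>"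
    using f extensionalityI[of f "carrier G" "\<lambda>g\<in>carrier G. \<one>\<^bsub>M\<^esub>"] by fastforce
  have "Reidemeister_number G \<phi> = \<infinity>" if \<phi>: "\<phi> \<in> carrier (AutoGroup G)" for \<phi>
  proof (rule f.Reidemeister_number_infinite_if_invariant_hom[OF T.M.comm_group_axioms])
    show "\<phi> \<in> hom G G"
      using \<phi> by (simp add: AutoGroup_def auto_def)
    show "f (\<phi> y) = f y" if "y \<in> carrier G" for y
      using T.fixed_class_imp_invariant_hom[OF f \<phi> _ that] assms(5) \<phi>
      by (simp add: \<xi> global_fixed_point_def)
    show "infinite (f ` carrier G)"
      by (rule f.infinite_image_if_torsion_free[OF assms(4) x])
  qed
  then show ?thesis
    by (simp add: R_infinity_def)
qed

end
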